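(* The converse of the implication "if $\mathbb{R}\setminus A$ is countable and scattered in $H(A)$, then $H(A)$ is $\sigma$-compact" fails: there exists a subset $A \subseteq \mathbb{R}$ such that $H(A)$ is $\sigma$-compact but it is not the case that $\mathbb{R} \setminus A$ is countable and scattered as a subspace of $H(A)$.
   Context: For $A \subseteq \mathbb{R}$, the Hattori space $H(A)$ is the set $\mathbb{R}$ with the topology $\tau(A)$ in which a point $x \in A$ has open neighbourhood basis $\{(x-\epsilon, x+\epsilon) : \epsilon > 0\}$ and a point $x \in \mathbb{R}\setminus A$ has open neighbourhood basis $\{[x, x+\epsilon) : \epsilon > 0\}$. A space is $\sigma$-compact if it is a union of countably many compact subsets. A space is scattered if each of its nonempty subspaces has an isolated point. *)

theory Defs
  imports "HOL-Analysis.Analysis"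
begin

definition hattori_nbhd :: "real set \<Rightarrow> real \<Rightarrow> real \<Rightarrow> real set" where
  "hattori_nbhd A x \<epsilon> = (if x \<in> A then {x - \<epsilon><..<x + \<epsilon>} else {x..<x + \<epsilon>})"

definition hattori_space :: "real set \<Rightarrow> real topology" where
  "hattori_space A = topology (\<lambda>U. \<forall>x\<in>U. \<exists>\<epsilon>>0. hattori_nbhd A x \<epsilon> \<subseteq> U)"

text \<open>The predicate above really is a topology on the whole real line, and
  the sets \<open>hattori_nbhd A x \<epsilon>\<close> with \<open>\<epsilon> > 0\<close> form an open neighbourhood basis at \<open>x\<close>.\<close>

lemma openin_hattori_space:
  "openin (hattori_space A) U \<longleftrightarrow> (\<forall>x\<in>U. \<exists>\<epsilon>>0. hattori_nbhd A x \<epsilon> \<subseteq> U)"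
proof -
  have mono: "hattori_nbhd A x d \<subseteq> hattori_nbhd A x e" if "d \<le> e" for x d e
    using that by (auto simp: hattori_nbhd_def)
  have "istopology (\<lambda>U. \<forall>x\<in>U. \<exists>\<epsilon>>0. hattori_nbhd A x \<epsilon> \<subseteq> U)"
    unfolding istopology_def
  proof (intro conjI allI impI ballI)
    fix S T x
    assume S: "\<forall>x\<in>S. \<exists>\<epsilon>>0. hattori_nbhd A x \<epsilon> \<subseteq> S"
      and T: "\<forall>x\<in>T. \<exists>\<epsilon>>0. hattori_nbhd A x \<epsilon> \<subseteq> T" and x: "x \<in> S \<inter> T"
    obtain d where d: "d > 0" "hattori_nbhd A x d \<subseteq> S" using S x by blast
    obtain e where e: "e > 0" "hattori_nbhd A x e \<subseteq> T" using T x by blast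
    have "hattori_nbhd A x (min d e) \<subseteq> S \<inter> T"
      using d e mono[of "min d e" d x] mono[of "min d e" e x] by auto
    then show "\<exists>\<epsilon>>0. hattori_nbhd A x \<epsilon> \<subseteq> S \<inter> T"
      using d e by (intro exI[of _ "min d e"]) auto
  next
    fix K x
    assume "\<forall>S\<in>K. \<forall>x\<in>S. \<exists>\<epsilon>>0. hattori_nbhd A x \<epsilon> \<subseteq> S" and "x \<in> \<Union>K"
    then show "\<exists>\<epsilon>>0. hattori_nbhd A x \<epsilon> \<subseteq> \<Union>K"
      by (meson Union_iff Union_upper subset_trans)
  qed
  then show ?thesis
    by (simp add: hattori_space_def topology_inverse')
qed

lemma topspace_hattori_space [simp]: "topspace (hattori_space A) = UNIV"
proof -
  have "openin (hattori_space A) UNIV"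
    by (auto simp: openin_hattori_space intro: exI[of _ 1])
  then show ?thesis
    using openin_subset by blast
qed

lemma openin_hattori_nbhd: "openin (hattori_space A) (hattori_nbhd A x \<epsilon>)"
  unfolding openin_hattori_space
proof
  fix y assume y: "y \<in> hattori_nbhd A x \<epsilon>"
  show "\<exists>d>0. hattori_nbhd A y d \<subseteq> hattori_nbhd A x \<epsilon>"
  proof (cases "y = x")
    case True
    with y have "\<epsilon> > 0" by (auto simp: hattori_nbhd_def split: if_splits)
    with True show ?thesis by blast
  next
    case False
    define d where "d = min (x + \<epsilon> - y) (if x \<in> A then y - (x - \<epsilon>) else y - x)"
    have "d > 0" "hattori_nbhd A y d \<subseteq> hattori_nbhd A x \<epsilon>"
      using y False by (auto simp: hattori_nbhd_def d_def split: if_splits)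
    then show ?thesis by blast
  qed
qed

definition sigma_compact_space :: "'a topology \<Rightarrow> bool" where
  "sigma_compact_space X \<longleftrightarrow>
    (\<exists>\<K>. countable \<K> \<and> (\<forall>K\<in>\<K>. compactin X K) \<and> \<Union>\<K> = topspace X)"

definition scattered_space :: "'a topology \<Rightarrow> bool" where
  "scattered_space X \<longleftrightarrow>
    (\<forall>S. S \<subseteq> topspace X \<and> S \<noteq> {} \<longrightarrow> (\<exists>x\<in>S. openin (subtopology X S) {x}))"

end

theory Submission
  imports Defs
begin

text \<open>Let \<open>B\<close> be the set of finite sums of distinct powers \<open>1/3, 1/9, 1/27, \<dots>\<close>, let \<open>K\<close> be its
  Euclidean closure (a Cantor set), and take \<open>A = \<real> - B\<close>. Every point of \<open>B\<close> is a limit of \<open>B\<close> from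
  the right, so \<open>B\<close> is not scattered in \<open>H(A)\<close>. On the other hand every point of \<open>B\<close> is isolated
  from the left in \<open>K\<close>, so the Hattori and Euclidean topologies agree on \<open>K\<close> and \<open>K\<close> is
  compact in \<open>H(A)\<close>; and \<open>\<real> - K \<subseteq> A\<close> is a countable union of Euclidean compact sets, which
  remain compact in \<open>H(A)\<close>.\<close>

text \<open>The hypothesis \<open>left\<close> makes the identity continuous from Euclidean
  \<open>C\<close> into the Hattori space: near a point outside \<open>A\<close>, a small enough
  ball meets \<open>C\<close> only at or to the right of that point. Compactness then passes to the
  image.\<close>

lemma compactin_hattori_space:
  assumes "compact C"
    and left: "\<And>x. x \<in> C - A \<Longrightarrow> \<exists>e>0. {x - e<..<x} \<inter> C = {}"
  shows "compactin (hattori_space A) C"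
proof -
  have "continuous_map (top_of_set C) (hattori_space A) id"
    unfolding continuous_map_alt
  proof (intro conjI allI impI)
    fix U assume U: "openin (hattori_space A) U"
    show "openin (top_of_set C) (id -` U \<inter> topspace (top_of_set C))"
      unfolding openin_contains_ball
    proof (intro conjI ballI)
      fix x assume x: "x \<in> id -` U \<inter> topspace (top_of_set C)"
      then obtain d where d: "d > 0" "hattori_nbhd A x d \<subseteq> U"
        using U by (auto simp: openin_hattori_space)
      show "\<exists>e>0. ball x e \<inter> C \<subseteq> id -` U \<inter> topspace (top_of_set C)"
      proof (cases "x \<in> A")
        case True
        then show ?thesis
          using d by (intro exI[of _ d]) (auto simp: hattori_nbhd_def ball_eq_greaterThanLessThan)
      next
        case False
        then obtain e where e: "e > 0" "{x - e<..<x} \<inter> C = {}"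
          using left x by auto
        have "y \<in> U" if "y \<in> ball x (min d e)" "y \<in> C" for y
        proof -
          have "\<not> y < x"
            using e that by (force simp: ball_eq_greaterThanLessThan)
          then have "y \<in> hattori_nbhd A x d"
            using that False by (auto simp: hattori_nbhd_def ball_eq_greaterThanLessThan)
          then show ?thesis using d by blast
        qed
        then show ?thesis
          using d e by (intro exI[of _ "min d e"]) auto
      qed
    qed auto
  qed auto
  moreover have "compactin (top_of_set C) C"
    using assms(1) by (simp add: compactin_subtopology)
  ultimately show ?thesis
    using image_compactin by fastforce
qed

text \<open>Base-3 expansions with digits 0 and 1 only, so the closure of the finite ones is the
  Cantor set scaled by 1/2. With exponent \<open>Suc n\<close>, digits below \<open>m\<close> give
  multiples of \<open>(1/3) ^ m\<close>.\<close>

definition ternary_sum :: "nat set \<Rightarrow> real" where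
  "ternary_sum F = (\<Sum>n\<in>F. (1/3) ^ Suc n)"

definition ternary_sums :: "real set" where
  "ternary_sums = ternary_sum ` {F. finite F}"

lemma ternary_sum_nonneg: "ternary_sum F \<ge> 0"
  unfolding ternary_sum_def by (intro sum_nonneg) auto

lemma ternary_tail_le:
  assumes "finite G" "G \<subseteq> {m..}"
  shows "ternary_sum G \<le> (1/3) ^ m / 2"
proof -
  obtain k where k: "G \<subseteq> {..<k}" using assms(1) finite_nat_iff_bounded by blast
  have "ternary_sum G \<le> ternary_sum {m..<m+k}"
    unfolding ternary_sum_def using assms k by (intro sum_mono2) force+
  \<comment> \<open>Closed form of the geometric sum, with the remainder kept so that the induction
    goes through.\<close>
  also have "\<dots> = (1/3) ^ m / 2 - (1/3) ^ (m+k) / 2"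
    by (induction k) (simp_all add: ternary_sum_def)
  also have "\<dots> \<le> (1/3) ^ m / 2" by simp
  finally show ?thesis .
qed

lemma ternary_sum_eq_of_int:
  assumes "F \<subseteq> {..<m}"
  shows "\<exists>i::int. ternary_sum F = of_int i * (1/3) ^ m"
proof -
  have "(1/3 :: real) ^ Suc n = of_int (3 ^ (m - Suc n)) * (1/3) ^ m" if "n \<in> F" for n
  proof -
    have "m = (m - Suc n) + Suc n" using assms that by fastforce
    then have "(1/3 :: real) ^ m = (1/3) ^ (m - Suc n) * (1/3) ^ Suc n"
      by (metis power_add)
    then show ?thesis by (simp add: power_divide)
  qed
  then have "ternary_sum F = of_int (\<Sum>n\<in>F. 3 ^ (m - Suc n)) * (1/3) ^ m"
    unfolding ternary_sum_def of_int_sum sum_distrib_right by (rule sum.cong[OF refl])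
  then show ?thesis by blast
qed

text \<open>Cutting \<open>G\<close> off at digit \<open>m\<close> leaves a multiple of
  \<open>(1/3) ^ m\<close> below that of \<open>F\<close>, hence below it by a whole unit; the
  discarded tail restores at most half a unit.\<close>

lemma ternary_sum_gap:
  assumes "F \<subseteq> {..<m}" "finite G" "ternary_sum G < ternary_sum F"
  shows "ternary_sum G \<le> ternary_sum F - (1/3) ^ m / 2"
proof -
  obtain i where i: "ternary_sum F = of_int i * (1/3) ^ m"
    using ternary_sum_eq_of_int assms(1) by blast
  obtain j where j: "ternary_sum (G \<inter> {..<m}) = of_int j * (1/3) ^ m"
    using ternary_sum_eq_of_int[of "G \<inter> {..<m}" m] by blast
  have split: "ternary_sum G = ternary_sum (G \<inter> {..<m}) + ternary_sum (G - {..<m})"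
    unfolding ternary_sum_def by (rule sum.Int_Diff[OF assms(2)])
  have tail: "ternary_sum (G - {..<m}) \<le> (1/3) ^ m / 2"
    using assms(2) by (intro ternary_tail_le) auto
  have "of_int j * (1/3) ^ m < of_int i * (1/3 :: real) ^ m"
    using split assms(3) i j ternary_sum_nonneg[of "G - {..<m}"] by linarith
  then have "j + 1 \<le> i" by simp
  then have "of_int (j + 1) * (1/3) ^ m \<le> of_int i * (1/3 :: real) ^ m"
    by (intro mult_right_mono) (simp_all only: of_int_le_iff, simp)
  then have "of_int j * (1/3) ^ m + (1/3) ^ m \<le> of_int i * (1/3 :: real) ^ m"
    by (simp add: algebra_simps)
  then show ?thesis using split tail i j by linarith
qed

lemma ternary_sums_left_isolated:
  assumes "x \<in> ternary_sums"
  shows "\<exists>e>0. {x - e<..<x} \<inter> closure ternary_sums = {}"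
proof -
  obtain F where F: "finite F" "x = ternary_sum F"
    using assms by (auto simp: ternary_sums_def)
  obtain m where m: "F \<subseteq> {..<m}" using F finite_nat_iff_bounded by blast
  have "{x - (1/3) ^ m / 2<..<x} \<inter> ternary_sums = {}"
    using ternary_sum_gap[OF m] F by (fastforce simp: ternary_sums_def)
  \<comment> \<open>An open set that misses a set also misses its closure.\<close>
  then have "{x - (1/3) ^ m / 2<..<x} \<inter> closure ternary_sums = {}"
    by (simp add: open_Int_closure_eq_empty)
  then show ?thesis by (intro exI[of _ "(1/3) ^ m / 2"]) simp
qed

lemma ternary_sums_right_limit:
  assumes "x \<in> ternary_sums" "e > 0"
  shows "\<exists>y\<in>ternary_sums. x < y \<and> y < x + e"
proof -
  obtain F where F: "finite F" "x = ternary_sum F"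
    using assms by (auto simp: ternary_sums_def)
  obtain m where m: "F \<subseteq> {..<m}" using F finite_nat_iff_bounded by blast
  obtain n where n: "(1/3 :: real) ^ n < e"
    using real_arch_pow_inv[OF assms(2), of "1/3"] by auto
  have "(1/3 :: real) ^ Suc (max m n) \<le> (1/3) ^ n"
    by (rule power_decreasing) auto
  then have "(1/3 :: real) ^ Suc (max m n) < e" using n by linarith
  \<comment> \<open>The digit \<open>max m n\<close> is new because it is at least \<open>m\<close>,
    and its weight is below \<open>e\<close> because it is at least \<open>n\<close>.\<close>
  moreover have "ternary_sum (insert (max m n) F) = x + (1/3) ^ Suc (max m n)"
  proof -
    have "max m n \<notin> F" using m by auto
    then show ?thesis using F by (simp add: ternary_sum_def)
  qed
  moreover have "ternary_sum (insert (max m n) F) \<in> ternary_sums"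
    using F(1) by (auto simp: ternary_sums_def)
  moreover have "(1/3 :: real) ^ Suc (max m n) > 0" by simp
  ultimately show ?thesis by (metis add_strict_left_mono less_add_same_cancel1)
qed

lemma compact_closure_ternary_sums: "compact (closure ternary_sums)"
proof -
  have "ternary_sums \<subseteq> {0..1/2}"
    using ternary_sum_nonneg ternary_tail_le[of _ 0] by (auto simp: ternary_sums_def)
  then show ?thesis
    unfolding compact_closure by (rule bounded_subset[OF bounded_closed_interval])
qed

lemma sigma_compact_hattori_space_ternary_sums:
  "sigma_compact_space (hattori_space (- ternary_sums))"
proof -
  let ?K = "closure ternary_sums"
  have "open (- ?K)" by auto
  then obtain D :: "nat \<Rightarrow> real set"
    where D: "\<And>n. compact (D n)" "\<And>n. D n \<subseteq> - ?K" "\<Union>(range D) = - ?K"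
    using open_Union_compact_subsets by metis
  have "compactin (hattori_space (- ternary_sums)) ?K"
    using compact_closure_ternary_sums ternary_sums_left_isolated
    by (intro compactin_hattori_space) auto
  moreover have "compactin (hattori_space (- ternary_sums)) (D n)" for n
  proof (rule compactin_hattori_space)
    show "compact (D n)" by (rule D)
    \<comment> \<open>Vacuous: \<open>D n\<close> avoids the closure, so it contains no point of
      \<open>ternary_sums\<close>.\<close>
    show "\<exists>e>0. {x - e<..<x} \<inter> D n = {}" if "x \<in> D n - - ternary_sums" for x
      using that D(2)[of n] closure_subset[of ternary_sums] by blast
  qed
  ultimately show ?thesis
    unfolding sigma_compact_space_def using D(3)
    by (intro exI[of _ "insert ?K (range D)"]) auto
qed

lemma not_scattered_ternary_sums:
  "\<not> scattered_space (subtopology (hattori_space (- ternary_sums)) ternary_sums)"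
proof
  let ?X = "subtopology (hattori_space (- ternary_sums)) ternary_sums"
  assume "scattered_space ?X"
  moreover have "ternary_sums \<noteq> {}" by (auto simp: ternary_sums_def)
  \<comment> \<open>Scatteredness is tested on the whole subspace, which has no isolated
    point.\<close>
  ultimately have "\<exists>x\<in>ternary_sums. openin (subtopology ?X ternary_sums) {x}"
    unfolding scattered_space_def by simp
  then obtain x where x: "x \<in> ternary_sums" and "openin ?X {x}"
    by (auto simp: subtopology_subtopology)
  then obtain U where U: "openin (hattori_space (- ternary_sums)) U" "{x} = U \<inter> ternary_sums"
    by (auto simp: openin_subtopology)
  then have "x \<in> U" by blast
  then obtain e where e: "e > 0" "hattori_nbhd (- ternary_sums) x e \<subseteq> U"
    using U(1) by (auto simp: openin_hattori_space)
  obtain y where y: "y \<in> ternary_sums" "x < y" "y < x + e"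
    using ternary_sums_right_limit[OF x e(1)] by blast
  then have "y \<in> U" using e x by (auto simp: hattori_nbhd_def)
  with y U(2) show False by (metis IntI less_irrefl singletonD)
qed

theorem corollary2p2:
  shows "\<exists>A :: real set. sigma_compact_space (hattori_space A) \<and>
    \<not> (countable (UNIV - A) \<and> scattered_space (subtopology (hattori_space A) (UNIV - A)))"
  using sigma_compact_hattori_space_ternary_sums not_scattered_ternary_sums
  by (intro exI[of _ "- ternary_sums"]) (simp add: Compl_eq_Diff_UNIV[symmetric])

end
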